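(* Let $m=m(n)$ and $k=k(n)$ be positive integer sequences with $n\ll m\ll n^2/\log^2 n$, and let $(j_n)$ be any sequence of positive integers with $j_n\leq n-k$. For each $n$, let $\boldsymbol{\sigma}_{n,m}$ be a permutation chosen uniformly at random from the set of permutations of $[n]$ with exactly $m$ inversions. Then \[\lim_{n\to\infty}\mathbb{P}\big(\boldsymbol{\sigma}_{n,m}(j_n)>\boldsymbol{\sigma}_{n,m}(j_n+k)\big)=\begin{cases}\tfrac12 & \text{if } k\ll m/n,\\ 0 & \text{if } k\gg m/n.\end{cases}\]
   Context: A permutation of length $n$ is a linear ordering $\sigma(1)\ldots\sigma(n)$ of $[n]$; an inversion is a pair $i<j$ with $\sigma(i)>\sigma(j)$. For sequences, $f\ll g$ (equivalently $g\gg f$) means $f/g\to0$ as $n\to\infty$. *)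

theory Defs
  imports "HOL-Probability.Probability" "HOL-Combinatorics.Permutations"
begin

definition much_less :: "(nat \<Rightarrow> real) \<Rightarrow> (nat \<Rightarrow> real) \<Rightarrow> bool"
    (infix \<open>\<lless>\<close> 50) where
  "f \<lless> g \<longleftrightarrow> (\<lambda>n. f n / g n) \<longlonglongrightarrow> 0"

definition inversions :: "nat \<Rightarrow> (nat \<Rightarrow> nat) \<Rightarrow> (nat \<times> nat) set" where
  "inversions n \<sigma> = {(i, j). i \<in> {1..n} \<and> j \<in> {1..n} \<and> i < j \<and> \<sigma> i > \<sigma> j}"

definition perms_inv :: "nat \<Rightarrow> nat \<Rightarrow> (nat \<Rightarrow> nat) set" where
  "perms_inv n m = {\<sigma>. \<sigma> permutes {1..n} \<and> card (inversions n \<sigma>) = m}"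

text \<open>
  Meaningful only if \<^term>\<open>perms_inv n m\<close> is nonempty, i.e. if \<open>m \<le> n (n - 1) / 2\<close>;
  otherwise \<^const>\<open>pmf_of_set\<close> is unspecified.
\<close>
definition random_perm :: "nat \<Rightarrow> nat \<Rightarrow> (nat \<Rightarrow> nat) pmf" where
  "random_perm n m = pmf_of_set (perms_inv n m)"

end

theory Submission
  imports Defs
begin

text \<open>
  A permutation of \<open>[n]\<close> with \<open>m\<close> inversions is encoded by its Lehmer code, a sequence with
  \<open>0 \<le> e i < i\<close> and sum \<open>m\<close>, where \<open>e i\<close> counts the larger values to the left of position \<open>i\<close>.
  Moving mass between entries of a code and double counting shows that an entry is rarely much
  larger than \<open>m / n\<close>, and that two given entries rarely differ by much less than \<open>m / n\<close>.

  If positions \<open>i\<close> and \<open>i + k\<close> form an inversion, then \<open>e i < e (i + k)\<close>, and conversely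
  \<open>e i + k \<le> e (i + k)\<close> forces an inversion. For \<open>k\<close> much smaller than \<open>m / n\<close> the two conditions
  have nearly the same probability, which is close to \<open>1 / 2\<close> because the two entries can be
  exchanged unless one of them is exceptionally large; the symmetry under reverse-complement
  allows one to assume that \<open>i\<close> is of order \<open>n\<close>. For \<open>k\<close> much larger than \<open>m / n\<close> an inversion
  forces \<open>i\<close> or \<open>i + k\<close> to take part in at least \<open>k / 2\<close> inversions on one side.
\<close>

section \<open>Double counting of moves\<close>

text \<open>Count pairs of an \<open>e\<close> in \<open>A\<close> and a label \<open>l\<close> of a
  move in \<open>M e\<close>. Each \<open>e\<close> supplies at least \<open>F\<close> pairs; by
  \<open>recover\<close> a pair is determined by outcome and label, so each outcome accounts for at
  most \<open>r\<close> of them.\<close>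

lemma double_count_le:
  fixes F r :: real
  assumes "finite A" "finite C"
    and forward: "\<And>e. e \<in> A \<Longrightarrow> finite (M e) \<and> F \<le> real (card (M e))"
    and target: "\<And>e l. e \<in> A \<Longrightarrow> l \<in> M e \<Longrightarrow> T e l \<in> C \<and> l \<in> R (T e l)"
    and recover: "\<And>e e' l. e \<in> A \<Longrightarrow> e' \<in> A \<Longrightarrow> l \<in> M e \<Longrightarrow> l \<in> M e' \<Longrightarrow> T e l = T e' l \<Longrightarrow> e = e'"
    and backward: "\<And>f. f \<in> C \<Longrightarrow> finite (R f) \<and> real (card (R f)) \<le> r"
  shows "real (card A) * F \<le> real (card C) * r"
proof -
  have inj: "inj_on (\<lambda>(e, l). (T e l, l)) (Sigma A M)"
    by (rule inj_onI) (use recover in force)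
  have sub: "(\<lambda>(e, l). (T e l, l)) ` Sigma A M \<subseteq> Sigma C R"
    using target by auto
  have "finite (Sigma C R)"
    using \<open>finite C\<close> backward by auto
  from card_inj_on_le[OF inj sub this] have le: "card (Sigma A M) \<le> card (Sigma C R)" .
  have "real (card A) * F = (\<Sum>e\<in>A. F)" by simp
  also have "\<dots> \<le> (\<Sum>e\<in>A. real (card (M e)))"
    using forward by (intro sum_mono) auto
  also have "\<dots> = real (card (Sigma A M))"
    using \<open>finite A\<close> forward by (subst card_SigmaI) auto
  also have "\<dots> \<le> real (card (Sigma C R))" using le by simp
  also have "\<dots> = (\<Sum>f\<in>C. real (card (R f)))"
    using \<open>finite C\<close> backward by (subst card_SigmaI) auto
  also have "\<dots> \<le> (\<Sum>f\<in>C. r)"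
    using backward by (intro sum_mono) auto
  also have "\<dots> = real (card C) * r" by simp
  finally show ?thesis .
qed

subsection \<open>Lehmer codes\<close>

definition code_box :: "nat \<Rightarrow> (nat \<Rightarrow> nat) set" where
  "code_box n = (\<Pi>\<^sub>E i\<in>{1..n}. {..<i})"

definition codes :: "nat \<Rightarrow> nat \<Rightarrow> (nat \<Rightarrow> nat) set" where
  "codes n m = {e \<in> code_box n. sum e {1..n} = m}"

text \<open>Restricting to \<open>{1..n}\<close> makes codes extensional, so that they are elements
  of the product \<open>code_box n\<close>.\<close>

definition lehmer :: "nat \<Rightarrow> (nat \<Rightarrow> nat) \<Rightarrow> nat \<Rightarrow> nat" where
  "lehmer n \<sigma> = (\<lambda>i\<in>{1..n}. card {l \<in> {1..<i}. \<sigma> l > \<sigma> i})"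

lemma finite_code_box: "finite (code_box n)"
  unfolding code_box_def by (intro finite_PiE) auto

lemma finite_codes: "finite (codes n m)"
  unfolding codes_def using finite_code_box by simp

lemma codes_less: "e \<in> codes n m \<Longrightarrow> i \<in> {1..n} \<Longrightarrow> e i < i"
  unfolding codes_def code_box_def by (simp add: PiE_iff)

lemma lehmer_in_box: "lehmer n \<sigma> \<in> code_box n"
  unfolding code_box_def
proof (rule PiE_I)
  fix i assume i: "i \<in> {1..n}"
  have "card {l \<in> {1..<i}. \<sigma> l > \<sigma> i} \<le> card {1..<i}"
    by (intro card_mono) auto
  then show "lehmer n \<sigma> i \<in> {..<i}" using i by (auto simp: lehmer_def)
qed (auto simp: lehmer_def)

lemma sum_lehmer: "sum (lehmer n \<sigma>) {1..n} = card (inversions n \<sigma>)"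
proof -
  have "inversions n \<sigma> = (\<lambda>(i, l). (l, i)) ` (SIGMA i:{1..n}. {l \<in> {1..<i}. \<sigma> l > \<sigma> i})"
    unfolding inversions_def by force
  then have "card (inversions n \<sigma>) = card (SIGMA i:{1..n}. {l \<in> {1..<i}. \<sigma> l > \<sigma> i})"
    by (simp add: card_image inj_on_def)
  also have "\<dots> = sum (lehmer n \<sigma>) {1..n}"
    by (subst card_SigmaI) (auto simp: lehmer_def)
  finally show ?thesis by simp
qed

text \<open>
  At the last position where two permutations differ, both choose from the same set of
  remaining values, and the code counts the remaining values above the chosen one.
\<close>
lemma inj_on_lehmer: "inj_on (lehmer n) {\<sigma>. \<sigma> permutes {1..n}}"
proof -
  have le: "\<not> \<sigma> i < \<tau> i"
    if perm: "\<sigma> permutes {1..n}" "\<tau> permutes {1..n}" and eq: "lehmer n \<sigma> = lehmer n \<tau>"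
      and i: "i \<in> {1..n}" and above: "\<And>l. i < l \<Longrightarrow> \<sigma> l = \<tau> l" for \<sigma> \<tau> i
  proof
    assume less: "\<sigma> i < \<tau> i"
    \<comment> \<open>The values still available at position \<open>i\<close> are those not taken to
      its right, hence the same for both permutations.\<close>
    have img: "\<pi> ` {1..i} = {1..n} - \<pi> ` {i<..n}" if "\<pi> permutes {1..n}" for \<pi>
    proof -
      have "{1..i} = {1..n} - {i<..n}" using i by auto
      then show ?thesis
        using permutes_inj[OF that] permutes_image[OF that] by (simp add: image_set_diff)
    qed
    have same: "\<sigma> ` {1..i} = \<tau> ` {1..i}"
      unfolding img[OF perm(1)] img[OF perm(2)] using above by (auto simp: image_iff)
    have cnt: "lehmer n \<pi> i = card {x \<in> \<pi> ` {1..i}. x > \<pi> i}" if "\<pi> permutes {1..n}" for \<pi>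
    proof -
      have "{x \<in> \<pi> ` {1..i}. x > \<pi> i} = \<pi> ` {l \<in> {1..<i}. \<pi> l > \<pi> i}"
        by (force simp: image_iff order.order_iff_strict)
      then show ?thesis
        using i permutes_inj_on[OF that] by (simp add: card_image lehmer_def)
    qed
    have "{x \<in> \<tau> ` {1..i}. x > \<tau> i} \<subset> {x \<in> \<sigma> ` {1..i}. x > \<sigma> i}"
      unfolding same using less i by auto
    then have "lehmer n \<tau> i < lehmer n \<sigma> i"
      unfolding cnt[OF perm(1)] cnt[OF perm(2)] by (intro psubset_card_mono) auto
    then show False using eq by simp
  qed
  show ?thesis
  proof (rule inj_onI, rule ccontr)
    fix \<sigma> \<tau> assume s: "\<sigma> \<in> {\<sigma>. \<sigma> permutes {1..n}}" and t: "\<tau> \<in> {\<sigma>. \<sigma> permutes {1..n}}"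
      and eq: "lehmer n \<sigma> = lehmer n \<tau>" and ne: "\<sigma> \<noteq> \<tau>"
    define D where "D = {i. \<sigma> i \<noteq> \<tau> i}"
    have D: "D \<subseteq> {1..n}"
      using s t unfolding D_def permutes_def by auto metis+
    then have fin: "finite D" using finite_subset by blast
    have ne': "D \<noteq> {}" using ne unfolding D_def by auto
    define i where "i = Max D"
    have iD: "i \<in> D" using Max_in[OF fin ne'] i_def by simp
    have above: "\<sigma> l = \<tau> l" if "i < l" for l
      using that Max_ge[OF fin, of l] unfolding i_def D_def by fastforce
    have "\<sigma> i = \<tau> i"
      using le[of \<sigma> \<tau> i] le[of \<tau> \<sigma> i] s t eq iD D above by force
    then show False using iD unfolding D_def by simp
  qed
qed

text \<open>The code is injective into a box of size n!, hence onto it; since the sum of a code is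
  the number of inversions, the bijection restricts to each \<open>m\<close>.\<close>

lemma bij_betw_lehmer: "bij_betw (lehmer n) (perms_inv n m) (codes n m)"
proof -
  let ?P = "{\<sigma>. \<sigma> permutes {1..n}}"
  have "card (lehmer n ` ?P) = fact n"
    using inj_on_lehmer by (simp add: card_image card_permutations)
  also have "\<dots> = card (code_box n)"
    unfolding code_box_def by (simp add: card_PiE fact_prod)
  finally have surj: "lehmer n ` ?P = code_box n"
    using lehmer_in_box finite_code_box by (intro card_subset_eq) auto
  have "lehmer n ` perms_inv n m = codes n m"
  proof (intro subset_antisym subsetI)
    fix e assume "e \<in> lehmer n ` perms_inv n m"
    then show "e \<in> codes n m"
      using sum_lehmer lehmer_in_box by (auto simp: perms_inv_def codes_def)
  next
    fix e assume e: "e \<in> codes n m"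
    then obtain \<sigma> where "\<sigma> permutes {1..n}" "e = lehmer n \<sigma>"
      using surj unfolding codes_def by blast
    then show "e \<in> lehmer n ` perms_inv n m"
      using e sum_lehmer[of n \<sigma>] by (auto simp: perms_inv_def codes_def)
  qed
  moreover have "inj_on (lehmer n) (perms_inv n m)"
    by (rule inj_on_subset[OF inj_on_lehmer]) (auto simp: perms_inv_def)
  ultimately show ?thesis by (simp add: bij_betw_def)
qed

lemma finite_perms_inv: "finite (perms_inv n m)"
  using bij_betw_finite[OF bij_betw_lehmer] finite_codes by blast

lemma card_perms_inv: "card (perms_inv n m) = card (codes n m)"
  by (rule bij_betw_same_card[OF bij_betw_lehmer])

lemma card_perms_inv_lehmer:
  "card {\<sigma> \<in> perms_inv n m. Q (lehmer n \<sigma>)} = card {e \<in> codes n m. Q e}"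
proof (rule bij_betw_same_card[of "lehmer n"])
  have inj: "inj_on (lehmer n) (perms_inv n m)" and img: "lehmer n ` perms_inv n m = codes n m"
    using bij_betw_lehmer by (auto simp: bij_betw_def)
  show "bij_betw (lehmer n) {\<sigma> \<in> perms_inv n m. Q (lehmer n \<sigma>)} {e \<in> codes n m. Q e}"
    unfolding bij_betw_def
  proof
    show "inj_on (lehmer n) {\<sigma> \<in> perms_inv n m. Q (lehmer n \<sigma>)}"
      by (rule inj_on_subset[OF inj]) auto
    show "lehmer n ` {\<sigma> \<in> perms_inv n m. Q (lehmer n \<sigma>)} = {e \<in> codes n m. Q e}"
      unfolding img[symmetric] by auto
  qed
qed

section \<open>Existence of codes and moves between entries\<close>

text \<open>Induction on \<open>m\<close>: as long as the sum is below its maximum, some entry is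
  below \<open>i - 1\<close> and can be raised by one.\<close>

lemma codes_nonempty:
  assumes "m \<le> (\<Sum>i\<in>{1..n}. i - 1)"
  shows "codes n m \<noteq> {}"
  using assms
proof (induction m)
  case 0
  have "(\<lambda>i\<in>{1..n}. 0) \<in> codes n 0"
    by (auto simp: codes_def code_box_def)
  then show ?case by blast
next
  case (Suc m)
  then obtain e where e: "e \<in> codes n m" by fastforce
  have "\<exists>i\<in>{1..n}. e i < i - 1"
  proof (rule ccontr)
    assume "\<not> ?thesis"
    then have "(\<Sum>i\<in>{1..n}. i - 1) \<le> sum e {1..n}"
      by (intro sum_mono) (auto simp: not_less)
    then show False using e Suc.prems by (simp add: codes_def)
  qed
  then obtain i where i: "i \<in> {1..n}" "e i < i - 1" by blast
  have "sum (e(i := Suc (e i))) {1..n} = Suc (sum e {1..n})"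
  proof -
    have "sum (e(i := Suc (e i))) ({1..n} - {i}) = sum e ({1..n} - {i})"
      by (intro sum.cong) auto
    then show ?thesis
      using i sum.remove[of "{1..n}" i e] sum.remove[of "{1..n}" i "e(i := Suc (e i))"] by simp
  qed
  moreover have "e(i := Suc (e i)) \<in> code_box n"
    using e i by (auto simp: codes_def code_box_def PiE_iff extensional_def)
  ultimately have "e(i := Suc (e i)) \<in> codes n (Suc m)"
    using e by (simp add: codes_def)
  then show ?case by blast
qed

lemma sum_two:
  fixes e :: "nat \<Rightarrow> nat"
  assumes "a \<in> {1..n}" "b \<in> {1..n}" "a \<noteq> b"
  shows "sum e {1..n} = e a + e b + sum e ({1..n} - {a, b})"
proof -
  have "sum e {1..n} = e a + sum e ({1..n} - {a})"
    using assms by (simp add: sum.remove)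
  also have "sum e ({1..n} - {a}) = e b + sum e ({1..n} - {a} - {b})"
    using assms by (intro sum.remove) auto
  also have "{1..n} - {a} - {b} = {1..n} - {a, b}" by auto
  finally show ?thesis by simp
qed

lemma codes_update_two:
  assumes e: "e \<in> codes n m" and ab: "a \<in> {1..n}" "b \<in> {1..n}" "a \<noteq> b"
    and "x < a" "y < b" "x + y = e a + e b"
  shows "e(a := x, b := y) \<in> codes n m"
proof -
  have "sum (e(a := x, b := y)) ({1..n} - {a, b}) = sum e ({1..n} - {a, b})"
    by (intro sum.cong) auto
  then have "sum (e(a := x, b := y)) {1..n} = sum e {1..n}"
    using assms sum_two[OF ab, of e] sum_two[OF ab, of "e(a := x, b := y)"] by simp
  moreover have "e(a := x, b := y) \<in> code_box n"
    using assms by (auto simp: codes_def code_box_def PiE_def extensional_def)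
  ultimately show ?thesis using e by (simp add: codes_def)
qed

lemma codes_markov:
  assumes "e \<in> codes n m"
  shows "card {b \<in> {1..n}. t \<le> e b} * t \<le> m"
proof -
  have "card {b \<in> {1..n}. t \<le> e b} * t = (\<Sum>b\<in>{b \<in> {1..n}. t \<le> e b}. t)" by simp
  also have "\<dots> \<le> (\<Sum>b\<in>{b \<in> {1..n}. t \<le> e b}. e b)" by (intro sum_mono) auto
  also have "\<dots> \<le> sum e {1..n}" by (intro sum_mono2) auto
  finally show ?thesis using assms by (simp add: codes_def)
qed

subsection \<open>Concentration of a single entry\<close>

text \<open>
  Moving an amount \<open>t\<close> from entry \<open>i\<close> to another entry is possible in about \<open>n / 2\<close> ways, but
  the receiving entry ends up at least \<open>t\<close>, so it is one of at most \<open>m / t\<close> entries.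
\<close>
lemma codes_tail:
  assumes i: "i \<in> {1..n}" and t: "0 < t" "4 * t \<le> n" and n: "8 \<le> n"
  shows "real (card {e \<in> codes n m. t \<le> e i}) \<le> 8 * real m / (real n * real t) * real (card (codes n m))"
\<comment> \<open>If the factor is at least 1, the bound is trivial. Otherwise
  \<open>m / t < n / 8\<close>, so few entries are too large to receive.\<close>
proof (cases "8 * real m / (real n * real t) \<ge> 1")
  case True
  have "card {e \<in> codes n m. t \<le> e i} \<le> card (codes n m)"
    by (intro card_mono finite_codes) auto
  then have "real (card {e \<in> codes n m. t \<le> e i}) \<le> 1 * real (card (codes n m))" by simp
  also have "\<dots> \<le> 8 * real m / (real n * real t) * real (card (codes n m))"
    using True by (intro mult_right_mono) auto
  finally show ?thesis .
next
  case False
  let ?A = "{e \<in> codes n m. t \<le> e i}" and ?C = "codes n m"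
  \<comment> \<open>A receiver has \<open>e b + t < 2 * t\<close>, which is at most n / 2 and so
    less than \<open>b\<close>: the move respects the bound of the code.\<close>
  let ?M = "\<lambda>e. {b \<in> {1..n}. n < 2 * b \<and> b \<noteq> i \<and> e b < t}"
  let ?T = "\<lambda>e b. e(i := e i - t, b := e b + t)"
  let ?R = "\<lambda>f. {b \<in> {1..n}. t \<le> f b}"
  have mark: "real (card (?R f)) \<le> real m / real t" if "f \<in> ?C" for f
  proof -
    have "real (card (?R f) * t) \<le> real m" using codes_markov[OF that, of t] of_nat_le_iff by blast
    then show ?thesis using t by (simp add: field_simps)
  qed
  have "real (card ?A) * (real n / 2 - 1 - real m / real t) \<le> real (card ?C) * (real m / real t)"
  proof (rule double_count_le[where M = ?M and T = ?T and R = ?R])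
    show "finite ?A" "finite ?C" using finite_codes by auto
  next
    fix e assume e: "e \<in> ?A"
    have "{n div 2 <.. n} \<subseteq> ?M e \<union> ({i} \<union> ?R e)" by auto
    then have "card {n div 2 <.. n} \<le> card (?M e \<union> ({i} \<union> ?R e))"
      by (intro card_mono) auto
    also have "\<dots> \<le> card (?M e) + card ({i} \<union> ?R e)" by (rule card_Un_le)
    also have "\<dots> \<le> card (?M e) + (card {i} + card (?R e))"
      by (intro add_left_mono card_Un_le)
    finally have "n - n div 2 \<le> card (?M e) + 1 + card (?R e)" by simp
    moreover have "real n / 2 \<le> real (n - n div 2)" by linarith
    ultimately have "real n / 2 \<le> real (card (?M e)) + 1 + real (card (?R e))" by linarith
    then show "finite (?M e) \<and> real n / 2 - 1 - real m / real t \<le> real (card (?M e))"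
      using mark[of e] e by auto
  next
    fix e b assume e: "e \<in> ?A" and b: "b \<in> ?M e"
    have "e i < i" using e i codes_less by blast
    then have "?T e b \<in> ?C"
      using e b i t by (intro codes_update_two) auto
    then show "?T e b \<in> ?C \<and> b \<in> ?R (?T e b)" using b by auto
  next
    fix e e' b assume e: "e \<in> ?A" "e' \<in> ?A" and b: "b \<in> ?M e" "b \<in> ?M e'" and eq: "?T e b = ?T e' b"
    show "e = e'"
    proof
      fix x
      show "e x = e' x"
        using fun_cong[OF eq, of x] e b by (auto split: if_splits)
    qed
  next
    fix f assume "f \<in> ?C"
    then show "finite (?R f) \<and> real (card (?R f)) \<le> real m / real t" using mark by auto
  qed
  moreover have "real n / 4 \<le> real n / 2 - 1 - real m / real t"
  proof -
    have "8 * real m < real n * real t" using False t n by (simp add: field_simps)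
    then have "real m / real t < real n / 8" using t by (simp add: field_simps)
    then show ?thesis using n by linarith
  qed
  ultimately have "real (card ?A) * (real n / 4) \<le> real (card ?C) * (real m / real t)"
    by (meson mult_left_mono of_nat_0_le_iff order_trans)
  then have "real (card ?A) \<le> 4 * (real m / (real n * real t)) * real (card ?C)"
    using t n by (simp add: field_simps)
  also have "\<dots> \<le> 8 * (real m / (real n * real t)) * real (card ?C)"
    by (intro mult_right_mono) auto
  finally show ?thesis by simp
qed

subsection \<open>Anticoncentration of the difference of two entries\<close>

text \<open>
  An amount \<open>d\<close> is moved from a third entry to entry \<open>a\<close>. Summing over all admissible \<open>d\<close> there
  are of order \<open>m\<close> such moves, whereas the outcome leaves at most \<open>2 k\<close> choices for \<open>d\<close>
  and \<open>n\<close> for the third entry. Capping \<open>d\<close> at \<open>n div 4\<close> keeps entry \<open>a\<close> below its bound.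
\<close>
lemma codes_anticoncentration:
  assumes ab: "a \<in> {1..n}" "b \<in> {1..n}" "a \<noteq> b" and a: "n \<le> 2 * a" and n: "8 \<le> n"
    and m: "4 * n \<le> m"
  shows "real (card {e \<in> codes n m. e a < n div 4 \<and> e a < e b + k \<and> e b < e a + k})
      \<le> 32 * real k * real n / real m * real (card (codes n m))"
proof -
  let ?h = "n div 4"
  let ?A = "{e \<in> codes n m. e a < ?h \<and> e a < e b + k \<and> e b < e a + k}" and ?C = "codes n m"
  let ?M = "\<lambda>e. SIGMA i:{1..n} - {a, b}. {1..min (e i) ?h}"
  let ?T = "\<lambda>e (i, d). e(i := e i - d, a := e a + d)"
  let ?S = "\<lambda>f. {d. d \<le> f a \<and> f a - d < f b + k \<and> f b < f a - d + k}"
  let ?R = "\<lambda>f. {1..n} \<times> ?S f"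
  have "real (card ?A) * (real m / 16) \<le> real (card ?C) * (real n * (2 * real k))"
  proof (rule double_count_le[where M = ?M and T = ?T and R = ?R])
    show "finite ?A" "finite ?C" using finite_codes by auto
  next
    fix e assume e: "e \<in> ?A"
    then have eC: "e \<in> ?C" by simp
    \<comment> \<open>Capping loses at most a factor 8, because \<open>e i < n\<close> and
      \<open>n div 4\<close> is at least n / 8 once \<open>8 \<le> n\<close>.\<close>
    have le: "real (e i) / 8 \<le> real (min (e i) ?h)" if "i \<in> {1..n}" for i
    proof -
      have "e i < n" using codes_less[OF eC that] that by auto
      then have "e i \<le> 8 * min (e i) ?h" using n by linarith
      then show ?thesis by linarith
    qed
    have "sum e {1..n} = m" using eC by (simp add: codes_def)
    moreover have "e a < n" "e b < n" using codes_less[OF eC] ab by fastforce+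
    \<comment> \<open>Leaving out \<open>a\<close> and \<open>b\<close> costs at most
      \<open>2 * n\<close>, that is, at most half of \<open>m\<close>.\<close>
    ultimately have "m \<le> 2 * n + sum e ({1..n} - {a, b})"
      using sum_two[OF ab, of e] by linarith
    then have "2 * sum e ({1..n} - {a, b}) \<ge> m" using m by linarith
    then have "real m / 16 \<le> real (sum e ({1..n} - {a, b})) / 8" by linarith
    also have "\<dots> = (\<Sum>i\<in>{1..n} - {a, b}. real (e i) / 8)" by (simp add: sum_divide_distrib)
    also have "\<dots> \<le> (\<Sum>i\<in>{1..n} - {a, b}. real (min (e i) ?h))"
      using le by (intro sum_mono) auto
    also have "\<dots> = real (card (?M e))" by (subst card_SigmaI) auto
    finally show "finite (?M e) \<and> real m / 16 \<le> real (card (?M e))" by auto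
  next
    fix e p assume e: "e \<in> ?A" and p: "p \<in> ?M e"
    obtain i d where p_eq: "p = (i, d)" by (cases p)
    with p have i: "i \<in> {1..n}" "i \<noteq> a" "i \<noteq> b" and d: "1 \<le> d" "d \<le> e i" "d \<le> ?h" by auto
    have "e i < i" using e i codes_less by blast
    moreover have "e a + d < a" using e d a by auto
    ultimately have "?T e p \<in> ?C"
      unfolding p_eq using e i d ab by (simp add: codes_update_two)
    then show "?T e p \<in> ?C \<and> p \<in> ?R (?T e p)"
      using e i ab unfolding p_eq by auto
  next
    fix e e' p assume e: "e \<in> ?A" "e' \<in> ?A" and p: "p \<in> ?M e" "p \<in> ?M e'" and eq: "?T e p = ?T e' p"
    obtain i d where p_eq: "p = (i, d)" by (cases p)
    show "e = e'"
    proof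
      fix x
      show "e x = e' x"
        using fun_cong[OF eq, of x] e p by (auto simp: p_eq split: if_splits)
    qed
  next
    fix f assume "f \<in> ?C"
    \<comment> \<open>Entry \<open>b\<close> is untouched by the move, so the old value
      \<open>f a - d\<close> lies in a window of radius \<open>k\<close> around \<open>f b\<close>;
      it determines \<open>d\<close> because \<open>d \<le> f a\<close>.\<close>
    have "card (?S f) \<le> card {f b + 1 - k..<f b + k}"
    proof (rule card_inj_on_le[where f = "\<lambda>d. f a - d"])
      show "inj_on (\<lambda>d. f a - d) (?S f)" by (auto simp: inj_on_def)
    qed auto
    also have "\<dots> \<le> 2 * k" by simp
    finally have "card (?R f) \<le> n * (2 * k)" by (simp add: card_cartesian_product)
    then have "real (card (?R f)) \<le> real (n * (2 * k))" using of_nat_le_iff by blast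
    moreover have "finite (?S f)" by (rule finite_subset[of _ "{..f a}"]) auto
    ultimately show "finite (?R f) \<and> real (card (?R f)) \<le> real n * (2 * real k)" by auto
  qed
  then show ?thesis using m n by (simp add: field_simps)
qed

subsection \<open>Inversions and codes\<close>

text \<open>Whatever exceeds the value at \<open>i\<close> also exceeds that at
  \<open>i + k\<close>, and \<open>i\<close> itself is counted in addition.\<close>

lemma inversion_imp_lehmer_less:
  assumes "\<sigma> (i + k) < \<sigma> i" "0 < i" "0 < k" "i + k \<le> n"
  shows "lehmer n \<sigma> i < lehmer n \<sigma> (i + k)"
proof -
  let ?L = "{l \<in> {1..<i}. \<sigma> l > \<sigma> i}" and ?R = "{l \<in> {1..<i + k}. \<sigma> l > \<sigma> (i + k)}"
  have "?L \<subseteq> ?R" using assms(1) by auto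
  moreover have "i \<in> ?R" "i \<notin> ?L" using assms by simp_all
  ultimately have "?L \<subset> ?R" by blast
  then show ?thesis
    using assms by (auto simp: lehmer_def intro!: psubset_card_mono)
qed

text \<open>Without the inversion, every position counted at \<open>i + k\<close> is either counted
  at \<open>i\<close> or is one of the \<open>k - 1\<close> positions in between.\<close>

lemma lehmer_ge_imp_inversion:
  assumes "\<sigma> permutes {1..n}" "lehmer n \<sigma> i + k \<le> lehmer n \<sigma> (i + k)" "0 < i" "0 < k" "i + k \<le> n"
  shows "\<sigma> (i + k) < \<sigma> i"
proof (rule ccontr)
  assume "\<not> ?thesis"
  then have le: "\<sigma> i \<le> \<sigma> (i + k)" by simp
  have "{l \<in> {1..<i + k}. \<sigma> l > \<sigma> (i + k)} \<subseteq> {l \<in> {1..<i}. \<sigma> l > \<sigma> i} \<union> {i<..<i + k}"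
  proof
    fix l assume l: "l \<in> {l \<in> {1..<i + k}. \<sigma> l > \<sigma> (i + k)}"
    then have "\<sigma> i < \<sigma> l" using le by simp
    then have "l \<noteq> i" by blast
    then show "l \<in> {l \<in> {1..<i}. \<sigma> l > \<sigma> i} \<union> {i<..<i + k}"
      using l \<open>\<sigma> i < \<sigma> l\<close> by (cases "l < i") simp_all
  qed
  then have "card {l \<in> {1..<i + k}. \<sigma> l > \<sigma> (i + k)} \<le> card ({l \<in> {1..<i}. \<sigma> l > \<sigma> i} \<union> {i<..<i + k})"
    by (intro card_mono) auto
  also have "\<dots> \<le> card {l \<in> {1..<i}. \<sigma> l > \<sigma> i} + card {i<..<i + k}" by (rule card_Un_le)
  finally have "lehmer n \<sigma> (i + k) \<le> lehmer n \<sigma> i + (k - 1)"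
    using assms by (simp add: lehmer_def)
  then show False using assms by linarith
qed

section \<open>Symmetry under reverse-complement\<close>

text \<open>Rotates the permutation diagram by a half turn: inversions are preserved, and left and
  right are exchanged. Points outside \<open>{1..n}\<close> stay fixed so that the result again
  permutes \<open>{1..n}\<close>.\<close>

definition revcomp :: "nat \<Rightarrow> (nat \<Rightarrow> nat) \<Rightarrow> nat \<Rightarrow> nat" where
  "revcomp n \<sigma> = (\<lambda>i. if i \<in> {1..n} then n + 1 - \<sigma> (n + 1 - i) else i)"

lemma revcomp_permutes:
  assumes "\<sigma> permutes {1..n}"
  shows "revcomp n \<sigma> permutes {1..n}"
proof (rule bij_imp_permutes)
  have flip: "bij_betw (\<lambda>i. n + 1 - i) {1..n} {1..n}"
    by (rule bij_betw_byWitness[where f' = "\<lambda>i. n + 1 - i"]) auto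
  have "bij_betw ((\<lambda>i. n + 1 - i) \<circ> (\<sigma> \<circ> (\<lambda>i. n + 1 - i))) {1..n} {1..n}"
    by (intro bij_betw_trans[OF bij_betw_trans[OF flip permutes_imp_bij[OF assms]] flip])
  then show "bij_betw (revcomp n \<sigma>) {1..n} {1..n}"
    by (rule bij_betw_cong[THEN iffD1, rotated]) (auto simp: revcomp_def)
qed (auto simp: revcomp_def)

lemma revcomp_revcomp:
  assumes "\<sigma> permutes {1..n}"
  shows "revcomp n (revcomp n \<sigma>) = \<sigma>"
proof
  fix i
  show "revcomp n (revcomp n \<sigma>) i = \<sigma> i"
    using permutes_in_image[OF assms, of i] permutes_not_in[OF assms, of i]
    by (auto simp: revcomp_def)
qed

lemma revcomp_less_iff:
  assumes "\<sigma> permutes {1..n}" "a \<in> {1..n}" "b \<in> {1..n}"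
  shows "revcomp n \<sigma> a < revcomp n \<sigma> b \<longleftrightarrow> \<sigma> (n + 1 - b) < \<sigma> (n + 1 - a)"
proof -
  have "\<sigma> (n + 1 - a) \<in> {1..n}" "\<sigma> (n + 1 - b) \<in> {1..n}"
    using assms by (auto simp only: permutes_in_image[OF assms(1)]) auto
  moreover have "n + 1 - x < n + 1 - y \<longleftrightarrow> y < x" if "x \<in> {1..n}" "y \<in> {1..n}" for x y
    using that by auto
  ultimately show ?thesis using assms by (simp add: revcomp_def)
qed

lemma revcomp_flip_less_iff:
  assumes "\<sigma> permutes {1..n}" "a \<in> {1..n}" "b \<in> {1..n}"
  shows "revcomp n \<sigma> (Suc n - a) < revcomp n \<sigma> (Suc n - b) \<longleftrightarrow> \<sigma> b < \<sigma> a"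
proof -
  have "Suc n - a \<in> {1..n}" "Suc n - b \<in> {1..n}" "n + 1 - (Suc n - a) = a" "n + 1 - (Suc n - b) = b"
    using assms by auto
  then show ?thesis using revcomp_less_iff[OF assms(1)] by metis
qed

lemma revcomp_perms_inv:
  assumes "\<sigma> \<in> perms_inv n m"
  shows "revcomp n \<sigma> \<in> perms_inv n m"
proof -
  have perm: "\<sigma> permutes {1..n}" using assms by (simp add: perms_inv_def)
  have "bij_betw (\<lambda>(a, b). (n + 1 - b, n + 1 - a)) (inversions n (revcomp n \<sigma>)) (inversions n \<sigma>)"
    by (rule bij_betw_byWitness[where f' = "\<lambda>(a, b). (n + 1 - b, n + 1 - a)"])
      (auto simp: inversions_def revcomp_less_iff[OF perm] revcomp_flip_less_iff[OF perm])
  then have "card (inversions n (revcomp n \<sigma>)) = card (inversions n \<sigma>)"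
    by (rule bij_betw_same_card)
  then show ?thesis using assms revcomp_permutes by (simp add: perms_inv_def)
qed

lemma card_perms_inv_revcomp:
  "card {\<sigma> \<in> perms_inv n m. Q (revcomp n \<sigma>)} = card {\<sigma> \<in> perms_inv n m. Q \<sigma>}"
proof (rule bij_betw_same_card[of "revcomp n"], rule bij_betw_byWitness[where f' = "revcomp n"])
  have rr: "revcomp n (revcomp n \<sigma>) = \<sigma>" if "\<sigma> \<in> perms_inv n m" for \<sigma>
    using that revcomp_revcomp by (simp add: perms_inv_def)
  then show "\<forall>a\<in>{\<sigma> \<in> perms_inv n m. Q (revcomp n \<sigma>)}. revcomp n (revcomp n a) = a"
    "\<forall>a'\<in>{\<sigma> \<in> perms_inv n m. Q \<sigma>}. revcomp n (revcomp n a') = a'" by auto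
  show "revcomp n ` {\<sigma> \<in> perms_inv n m. Q (revcomp n \<sigma>)} \<subseteq> {\<sigma> \<in> perms_inv n m. Q \<sigma>}"
    "revcomp n ` {\<sigma> \<in> perms_inv n m. Q \<sigma>} \<subseteq> {\<sigma> \<in> perms_inv n m. Q (revcomp n \<sigma>)}"
    using revcomp_perms_inv rr by auto
qed

text \<open>
  Every position strictly between \<open>i\<close> and \<open>i + k\<close> forms an inversion with one of the two ends.
  Inversions to the right of \<open>i\<close> are counted by the code of the reverse-complement.
\<close>
lemma inversion_imp_lehmer_sum:
  assumes perm: "\<sigma> permutes {1..n}" and inv: "\<sigma> (i + k) < \<sigma> i" and "0 < i" "0 < k" "i + k \<le> n"
  shows "k < lehmer n \<sigma> (i + k) + lehmer n (revcomp n \<sigma>) (n + 1 - i)"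
proof -
  let ?L = "{l \<in> {1..<i + k}. \<sigma> l > \<sigma> (i + k)}" and ?R = "{l \<in> {i<..n}. \<sigma> l < \<sigma> i}"
  have "bij_betw (\<lambda>l. n + 1 - l) {l \<in> {1..<n + 1 - i}. revcomp n \<sigma> l > revcomp n \<sigma> (n + 1 - i)} ?R"
    using assms by (intro bij_betw_byWitness[where f' = "\<lambda>l. n + 1 - l"])
      (auto simp: revcomp_less_iff[OF perm] revcomp_flip_less_iff[OF perm])
  then have R: "lehmer n (revcomp n \<sigma>) (n + 1 - i) = card ?R"
    using assms bij_betw_same_card by (fastforce simp: lehmer_def)
  have ne: "\<sigma> l \<noteq> \<sigma> (i + k)" if "l \<noteq> i + k" for l
    using that permutes_inj[OF perm] by (auto dest: injD)
  \<comment> \<open>Each set also contains the opposite end of the inversion. Removing both ends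
    lets the \<open>k - 1\<close> inner positions give the strict bound.\<close>
  have "{i<..<i + k} \<subseteq> (?L - {i}) \<union> (?R - {i + k})"
  proof
    fix l assume l: "l \<in> {i<..<i + k}"
    then have "\<sigma> l \<noteq> \<sigma> (i + k)" using ne by auto
    then show "l \<in> (?L - {i}) \<union> (?R - {i + k})"
      using l assms by auto
  qed
  then have "card {i<..<i + k} \<le> card ((?L - {i}) \<union> (?R - {i + k}))"
    by (intro card_mono) auto
  also have "\<dots> \<le> card (?L - {i}) + card (?R - {i + k})" by (rule card_Un_le)
  also have "\<dots> = (card ?L - 1) + (card ?R - 1)"
    using assms by (subst (1 2) card_Diff_singleton) auto
  finally have "k - 1 \<le> (card ?L - 1) + (card ?R - 1)" by simp
  moreover have "i \<in> ?L" "i + k \<in> ?R" using assms by auto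
  then have "?L \<noteq> {}" "?R \<noteq> {}" by blast+
  then have "0 < card ?L" "0 < card ?R" by (simp_all only: card_gt_0_iff) simp_all
  moreover have "lehmer n \<sigma> (i + k) = card ?L" using assms by (simp add: lehmer_def)
  ultimately show ?thesis using R \<open>0 < k\<close> by linarith
qed

subsection \<open>The probability of an inversion\<close>

lemma prob_random_perm:
  assumes "codes n m \<noteq> {}"
  shows "measure_pmf.prob (random_perm n m) {\<sigma>. Q \<sigma>}
    = real (card {\<sigma> \<in> perms_inv n m. Q \<sigma>}) / real (card (codes n m))"
proof -
  have "perms_inv n m \<noteq> {}"
    using assms bij_betw_lehmer[of n m] by (auto simp: bij_betw_def)
  moreover have "perms_inv n m \<inter> {\<sigma>. Q \<sigma>} = {\<sigma> \<in> perms_inv n m. Q \<sigma>}" by auto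
  ultimately show ?thesis
    by (simp add: random_perm_def measure_pmf_of_set finite_perms_inv card_perms_inv)
qed

lemma prob_inversion_far:
  assumes ne: "codes n m \<noteq> {}" and ik: "0 < i" "0 < k" "i + k \<le> n" and n: "8 \<le> n"
  shows "measure_pmf.prob (random_perm n m) {\<sigma>. \<sigma> i > \<sigma> (i + k)}
    \<le> 32 * ((real m / real n) / real k) + 128 * (real m / (real n)\<^sup>2)"
proof -
  \<comment> \<open>Two numbers with sum above \<open>k\<close> cannot both be below
    \<open>(k + 1) div 2\<close>. The cap \<open>n div 4\<close> meets the hypothesis of
    \<open>codes_tail\<close> and is the source of the error term in m / n^2.\<close>
  define t where "t = min ((k + 1) div 2) (n div 4)"
  have t: "0 < t" "4 * t \<le> n" using ik n by (auto simp: t_def)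
  let ?N = "real (card (codes n m))"
  let ?P = "perms_inv n m" and ?b = "8 * real m / (real n * real t)"
  have N: "0 < ?N" using ne finite_codes by (simp add: card_gt_0_iff)
  have "{\<sigma> \<in> ?P. \<sigma> i > \<sigma> (i + k)}
    \<subseteq> {\<sigma> \<in> ?P. t \<le> lehmer n \<sigma> (i + k)} \<union> {\<sigma> \<in> ?P. t \<le> lehmer n (revcomp n \<sigma>) (n + 1 - i)}"
  proof
    fix \<sigma> assume s: "\<sigma> \<in> {\<sigma> \<in> ?P. \<sigma> i > \<sigma> (i + k)}"
    then have "k < lehmer n \<sigma> (i + k) + lehmer n (revcomp n \<sigma>) (n + 1 - i)"
      using ik by (intro inversion_imp_lehmer_sum) (auto simp: perms_inv_def)
    then have "t \<le> lehmer n \<sigma> (i + k) \<or> t \<le> lehmer n (revcomp n \<sigma>) (n + 1 - i)"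
      unfolding t_def by linarith
    then show "\<sigma> \<in> {\<sigma> \<in> ?P. t \<le> lehmer n \<sigma> (i + k)} \<union> {\<sigma> \<in> ?P. t \<le> lehmer n (revcomp n \<sigma>) (n + 1 - i)}"
      using s by blast
  qed
  then have "card {\<sigma> \<in> ?P. \<sigma> i > \<sigma> (i + k)}
    \<le> card ({\<sigma> \<in> ?P. t \<le> lehmer n \<sigma> (i + k)} \<union> {\<sigma> \<in> ?P. t \<le> lehmer n (revcomp n \<sigma>) (n + 1 - i)})"
    by (intro card_mono) (auto simp: finite_perms_inv)
  also have "\<dots> \<le> card {\<sigma> \<in> ?P. t \<le> lehmer n \<sigma> (i + k)}
      + card {\<sigma> \<in> ?P. t \<le> lehmer n (revcomp n \<sigma>) (n + 1 - i)}"
    by (rule card_Un_le)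
  also have "\<dots> = card {e \<in> codes n m. t \<le> e (i + k)} + card {e \<in> codes n m. t \<le> e (n + 1 - i)}"
    by (simp only: card_perms_inv_revcomp[where Q = "\<lambda>\<sigma>. t \<le> lehmer n \<sigma> (n + 1 - i)"]
        card_perms_inv_lehmer[where Q = "\<lambda>e. t \<le> e (i + k)"]
        card_perms_inv_lehmer[where Q = "\<lambda>e. t \<le> e (n + 1 - i)"])
  finally have "real (card {\<sigma> \<in> ?P. \<sigma> i > \<sigma> (i + k)})
    \<le> real (card {e \<in> codes n m. t \<le> e (i + k)}) + real (card {e \<in> codes n m. t \<le> e (n + 1 - i)})"
    by linarith
  also have "\<dots> \<le> ?b * ?N + ?b * ?N"
    using ik t n by (intro add_mono codes_tail) auto
  finally have "measure_pmf.prob (random_perm n m) {\<sigma>. \<sigma> i > \<sigma> (i + k)} \<le> 16 * (real m / real n) * (1 / real t)"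
    unfolding prob_random_perm[OF ne] using N by (simp add: field_simps)
  also have "\<dots> \<le> 16 * (real m / real n) * (2 / real k + 8 / real n)"
  proof (intro mult_left_mono)
    have "real k / 2 \<le> real t \<or> real n / 8 \<le> real t"
      using n unfolding t_def by linarith
    then show "1 / real t \<le> 2 / real k + 8 / real n"
    proof
      assume "real k / 2 \<le> real t"
      then have "1 / real t \<le> 2 / real k" using ik t by (simp add: field_simps)
      then show ?thesis by (simp add: add_increasing2)
    next
      assume "real n / 8 \<le> real t"
      then have "1 / real t \<le> 8 / real n" using n t by (simp add: field_simps)
      then show ?thesis by (simp add: add_increasing)
    qed
  qed auto
  also have "\<dots> = 32 * ((real m / real n) / real k) + 128 * (real m / (real n)\<^sup>2)"
    by (simp add: algebra_simps power2_eq_square)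
  finally show ?thesis .
qed

text \<open>Exchanging the entries is legal when \<open>e a < b\<close>. This is automatic if
  \<open>e a < e b\<close>, since \<open>e b < b\<close>; in the other direction it must be
  imposed.\<close>

lemma card_codes_swap_le:
  assumes ab: "a \<in> {1..n}" "b \<in> {1..n}" "b < a"
  shows "card {e \<in> codes n m. e a < e b} \<le> card {e \<in> codes n m. e b < e a}"
    and "card {e \<in> codes n m. e b < e a \<and> e a < b} \<le> card {e \<in> codes n m. e a < e b}"
proof -
  let ?sw = "\<lambda>e::nat \<Rightarrow> nat. e(a := e b, b := e a)"
  have inj: "inj_on ?sw A" for A
  proof (rule inj_onI)
    fix e e' assume eq: "?sw e = ?sw e'"
    show "e = e'"
    proof
      fix x
      show "e x = e' x"
        using fun_cong[OF eq, of x] fun_cong[OF eq, of a] fun_cong[OF eq, of b] ab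
        by (auto split: if_splits)
    qed
  qed
  have sw: "?sw e \<in> codes n m" if "e \<in> codes n m" "e a < b" for e
    using that ab codes_less[OF that(1), of b] by (intro codes_update_two) auto
  have "e a < b" if "e \<in> codes n m" "e a < e b" for e
    using that ab codes_less[OF that(1), of b] by linarith
  then show "card {e \<in> codes n m. e a < e b} \<le> card {e \<in> codes n m. e b < e a}"
    using sw ab by (intro card_inj_on_le[OF inj]) (auto simp: finite_codes)
  show "card {e \<in> codes n m. e b < e a \<and> e a < b} \<le> card {e \<in> codes n m. e a < e b}"
    using sw ab by (intro card_inj_on_le[OF inj]) (auto simp: finite_codes)
qed

text \<open>The condition \<open>right\<close> puts position \<open>i + k\<close> in the right half,
  where \<open>codes_anticoncentration\<close> applies.\<close>

lemma prob_inversion_near_right: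
  assumes ne: "codes n m \<noteq> {}" and ik: "0 < i" "0 < k" "i + k \<le> n" and n: "8 \<le> n"
    and m: "4 * n \<le> m" and k: "2 * k \<le> n" and right: "n \<le> 2 * i + k"
  shows "\<bar>measure_pmf.prob (random_perm n m) {\<sigma>. \<sigma> i > \<sigma> (i + k)} - 1 / 2\<bar>
    \<le> 64 * (real m / (real n)\<^sup>2) + 32 * (real k / (real m / real n))"
proof -
  let ?h = "n div 4" and ?C = "codes n m" and ?P = "perms_inv n m"
  let ?N = "card ?C" and ?a = "i + k"
  have N: "0 < ?N" using ne finite_codes by (simp add: card_gt_0_iff)
  have a: "?a \<in> {1..n}" and i: "i \<in> {1..n}" using ik by auto
  \<comment> \<open>\<open>x\<close>, \<open>y\<close> and \<open>z\<close> split the codes by the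
    order of the two entries; \<open>u\<close> and \<open>w\<close> count the exceptions, a large
    entry or two close entries.\<close>
  define p where "p = card {\<sigma> \<in> ?P. \<sigma> i > \<sigma> ?a}"
  define x where "x = card {e \<in> ?C. e i < e ?a}"
  define y where "y = card {e \<in> ?C. e ?a < e i}"
  define z where "z = card {e \<in> ?C. e ?a = e i}"
  define u where "u = card {e \<in> ?C. ?h \<le> e ?a}"
  define w where "w = card {e \<in> ?C. e ?a < ?h \<and> e ?a < e i + k \<and> e i < e ?a + k}"
  have xyz: "?N = x + y + z"
  proof -
    have "?C = ({e \<in> ?C. e i < e ?a} \<union> {e \<in> ?C. e ?a < e i}) \<union> {e \<in> ?C. e ?a = e i}" by auto
    then have "?N = card (({e \<in> ?C. e i < e ?a} \<union> {e \<in> ?C. e ?a < e i}) \<union> {e \<in> ?C. e ?a = e i})"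
      by simp
    also have "\<dots> = x + y + z"
      unfolding x_def y_def z_def by (subst card_Un_disjoint; (subst card_Un_disjoint)?) (auto simp: finite_codes)
    finally show ?thesis .
  qed
  have yx: "y \<le> x"
    unfolding x_def y_def using card_codes_swap_le(1)[OF a i] ik by simp
  have xy: "x \<le> y + u"
  proof -
    \<comment> \<open>From \<open>k\<close> and \<open>right\<close>, \<open>i\<close> is at least n
      / 4, so an entry below \<open>?h\<close> fits at position \<open>i\<close>.\<close>
    have "{e \<in> ?C. e i < e ?a} \<subseteq> {e \<in> ?C. e i < e ?a \<and> e ?a < i} \<union> {e \<in> ?C. ?h \<le> e ?a}"
      using k right by auto
    then have "x \<le> card ({e \<in> ?C. e i < e ?a \<and> e ?a < i} \<union> {e \<in> ?C. ?h \<le> e ?a})"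
      unfolding x_def by (intro card_mono) (auto simp: finite_codes)
    also have "\<dots> \<le> card {e \<in> ?C. e i < e ?a \<and> e ?a < i} + u"
      unfolding u_def by (rule card_Un_le)
    also have "\<dots> \<le> y + u"
      unfolding y_def using card_codes_swap_le(2)[OF a i] ik by simp
    finally show ?thesis .
  qed
  have px: "p \<le> x"
  proof -
    have "p \<le> card {\<sigma> \<in> ?P. lehmer n \<sigma> i < lehmer n \<sigma> ?a}"
      unfolding p_def using inversion_imp_lehmer_less ik
      by (intro card_mono) (auto simp: finite_perms_inv)
    also have "\<dots> = x"
      unfolding x_def by (rule card_perms_inv_lehmer[where Q = "\<lambda>e. e i < e ?a"])
    finally show ?thesis .
  qed
  have xp: "x + z \<le> p + u + w"
  proof -
    have perm: "\<sigma> permutes {1..n}" if "\<sigma> \<in> ?P" for \<sigma>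
      using that by (simp add: perms_inv_def)
    have "card {e \<in> ?C. e i + k \<le> e ?a} = card {\<sigma> \<in> ?P. lehmer n \<sigma> i + k \<le> lehmer n \<sigma> ?a}"
      by (rule card_perms_inv_lehmer[where Q = "\<lambda>e. e i + k \<le> e ?a", symmetric])
    also have "\<dots> \<le> p"
      unfolding p_def using lehmer_ge_imp_inversion[OF perm] ik
      by (intro card_mono) (auto simp: finite_perms_inv)
    finally have ge: "card {e \<in> ?C. e i + k \<le> e ?a} \<le> p" .
    let ?W = "{e \<in> ?C. e ?a < ?h \<and> e ?a < e i + k \<and> e i < e ?a + k}"
    have "x + z = card ({e \<in> ?C. e i < e ?a} \<union> {e \<in> ?C. e ?a = e i})"
      unfolding x_def z_def by (subst card_Un_disjoint) (auto simp: finite_codes)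
    \<comment> \<open>If \<open>e i \<le> e ?a\<close>, then the gap is at least \<open>k\<close>,
      or \<open>e ?a\<close> is large, or the entries are close.\<close>
    also have "\<dots> \<le> card (({e \<in> ?C. e i + k \<le> e ?a} \<union> {e \<in> ?C. ?h \<le> e ?a}) \<union> ?W)"
      using ik by (intro card_mono) (auto simp: finite_codes)
    also have "\<dots> \<le> card ({e \<in> ?C. e i + k \<le> e ?a} \<union> {e \<in> ?C. ?h \<le> e ?a}) + w"
      unfolding w_def by (rule card_Un_le)
    also have "\<dots> \<le> card {e \<in> ?C. e i + k \<le> e ?a} + u + w"
      unfolding u_def by (intro add_right_mono card_Un_le)
    finally show ?thesis using ge by linarith
  qed
  \<comment> \<open>\<open>px\<close> and \<open>xp\<close> place \<open>p\<close> between
    \<open>x + z - u - w\<close> and \<open>x\<close>, while \<open>x\<close> and \<open>y\<close>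
    differ by at most \<open>u\<close> and \<open>x + y + z\<close> is the total.\<close>
  have "\<bar>real p - real ?N / 2\<bar> \<le> real u + real w"
    using xyz yx xy px xp by linarith
  moreover have "real u \<le> 8 * real m / (real n * real ?h) * real ?N"
    unfolding u_def using a n by (intro codes_tail) auto
  moreover have "8 * real m / (real n * real ?h) \<le> 64 * (real m / (real n)\<^sup>2)"
  proof -
    have "real n / 8 \<le> real ?h" using n by linarith
    then have "8 * real m / (real n * real ?h) \<le> 8 * real m / (real n * (real n / 8))"
      using n by (intro divide_left_mono mult_left_mono mult_pos_pos) auto
    then show ?thesis by (simp add: power2_eq_square)
  qed
  then have "8 * real m / (real n * real ?h) * real ?N \<le> 64 * (real m / (real n)\<^sup>2) * real ?N"
    by (rule mult_right_mono) simp
  moreover have "real w \<le> 32 * real k * real n / real m * real ?N"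
    unfolding w_def using a i n m ik right by (intro codes_anticoncentration) auto
  ultimately have "\<bar>real p - real ?N / 2\<bar>
    \<le> (64 * (real m / (real n)\<^sup>2) + 32 * (real k / (real m / real n))) * real ?N"
    by (simp add: algebra_simps)
  moreover have "\<bar>real p / real ?N - 1 / 2\<bar> = \<bar>real p - real ?N / 2\<bar> / real ?N"
  proof -
    have "real p / real ?N - 1 / 2 = (real p - real ?N / 2) / real ?N"
      using N by (simp add: field_simps)
    then show ?thesis using N by (simp add: abs_divide)
  qed
  ultimately show ?thesis
    unfolding prob_random_perm[OF ne] p_def[symmetric] using N by (simp add: pos_divide_le_eq)
qed

lemma prob_inversion_near:
  assumes ne: "codes n m \<noteq> {}" and ik: "0 < i" "0 < k" "i + k \<le> n" and n: "8 \<le> n"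
    and m: "4 * n \<le> m" and k: "2 * k \<le> n"
  shows "\<bar>measure_pmf.prob (random_perm n m) {\<sigma>. \<sigma> i > \<sigma> (i + k)} - 1 / 2\<bar>
    \<le> 64 * (real m / (real n)\<^sup>2) + 32 * (real k / (real m / real n))"
proof (cases "n \<le> 2 * i + k")
  case True
  then show ?thesis using prob_inversion_near_right assms by blast
next
  case False
  \<comment> \<open>The reflection sends the pair of positions \<open>i\<close>,
    \<open>i + k\<close> to the pair \<open>i'\<close>, \<open>i' + k\<close>, which satisfies the
    condition on the right half.\<close>
  define i' where "i' = n + 1 - i - k"
  have i': "0 < i'" "i' + k \<le> n" "n \<le> 2 * i' + k" "n + 1 - i' = i + k" "n + 1 - (i' + k) = i"
    using ik False by (auto simp: i'_def)
  have "{\<sigma> \<in> perms_inv n m. \<sigma> i > \<sigma> (i + k)}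
    = {\<sigma> \<in> perms_inv n m. revcomp n \<sigma> i' > revcomp n \<sigma> (i' + k)}"
    using i' by (intro Collect_cong conj_cong refl) (auto simp: perms_inv_def revcomp_less_iff)
  then have "card {\<sigma> \<in> perms_inv n m. \<sigma> i > \<sigma> (i + k)} = card {\<sigma> \<in> perms_inv n m. \<sigma> i' > \<sigma> (i' + k)}"
    using card_perms_inv_revcomp[where Q = "\<lambda>\<sigma>. \<sigma> i' > \<sigma> (i' + k)"] by simp
  then have "measure_pmf.prob (random_perm n m) {\<sigma>. \<sigma> i > \<sigma> (i + k)}
    = measure_pmf.prob (random_perm n m) {\<sigma>. \<sigma> i' > \<sigma> (i' + k)}"
    unfolding prob_random_perm[OF ne] by simp
  then show ?thesis using prob_inversion_near_right[OF ne i'(1) ik(2) i'(2) n m k i'(3)] by simp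
qed

section \<open>Passage to the limit\<close>

text \<open>Guarantees that \<open>random_perm n m\<close> is a genuine uniform
  distribution.\<close>

lemma codes_nonempty_square:
  assumes "4 * m \<le> n\<^sup>2" "2 \<le> n"
  shows "codes n m \<noteq> {}"
proof (rule codes_nonempty)
  have sum: "2 * (\<Sum>i\<in>{1..n}. i - 1) = n * (n - 1)" for n :: nat
    by (induction n) (auto simp: algebra_simps)
  have "n * n \<le> n * (2 * (n - 1))" using assms by (intro mult_left_mono) auto
  then have "4 * m \<le> 4 * (\<Sum>i\<in>{1..n}. i - 1)"
    using assms sum[of n] unfolding power2_eq_square by linarith
  then show "m \<le> (\<Sum>i\<in>{1..n}. i - 1)" by simp
qed

theorem theorem4:
  fixes m k j :: "nat \<Rightarrow> nat"
  assumes m_pos: "\<And>n. m n > 0"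
    and k_pos: "\<And>n. k n > 0"
    and j_pos: "\<And>n. j n > 0"
    and m_lower: "(\<lambda>n. real n) \<lless> (\<lambda>n. real (m n))"
    and m_upper: "(\<lambda>n. real (m n)) \<lless> (\<lambda>n. (real n)\<^sup>2 / (ln (real n))\<^sup>2)"
    and j_le: "eventually (\<lambda>n. int (j n) \<le> int n - int (k n)) sequentially"
  shows "((\<lambda>n. real (k n)) \<lless> (\<lambda>n. real (m n) / real n) \<longrightarrow>
           (\<lambda>n. measure_pmf.prob (random_perm n (m n)) {\<sigma>. \<sigma> (j n) > \<sigma> (j n + k n)})
             \<longlonglongrightarrow> 1 / 2) \<and>
         ((\<lambda>n. real (m n) / real n) \<lless> (\<lambda>n. real (k n)) \<longrightarrow>
           (\<lambda>n. measure_pmf.prob (random_perm n (m n)) {\<sigma>. \<sigma> (j n) > \<sigma> (j n + k n)})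
             \<longlonglongrightarrow> 0)"
proof (intro conjI impI)
  let ?pr = "\<lambda>n. measure_pmf.prob (random_perm n (m n)) {\<sigma>. \<sigma> (j n) > \<sigma> (j n + k n)}"
  let ?q = "\<lambda>n. real (m n) / (real n)\<^sup>2"
  have q0: "?q \<longlonglongrightarrow> 0"
  proof (rule tendsto_sandwich[of "\<lambda>_. 0" _ _ "\<lambda>n. real (m n) / ((real n)\<^sup>2 / (ln (real n))\<^sup>2)"])
    show "(\<lambda>n. real (m n) / ((real n)\<^sup>2 / (ln (real n))\<^sup>2)) \<longlonglongrightarrow> 0"
      using m_upper by (simp add: much_less_def)
    \<comment> \<open>For n at least 3 the logarithm is at least 1, so the extra factor only
      enlarges the ratio.\<close>
    show "\<forall>\<^sub>F n in sequentially. ?q n \<le> real (m n) / ((real n)\<^sup>2 / (ln (real n))\<^sup>2)"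
      using eventually_ge_at_top[of 3]
    proof eventually_elim
      case (elim n)
      have "1 \<le> ln (real n)"
        using elim exp_le by (subst ln_ge_iff) auto
      then have "1 \<le> (ln (real n))\<^sup>2" by (simp add: one_le_power)
      then have "?q n * 1 \<le> ?q n * (ln (real n))\<^sup>2" by (intro mult_left_mono) auto
      then show ?case by (simp add: field_simps)
    qed
  qed auto
  have big: "\<forall>\<^sub>F n in sequentially. 4 * n \<le> m n"
  proof -
    have "(\<lambda>n. real n / real (m n)) \<longlonglongrightarrow> 0" using m_lower by (simp add: much_less_def)
    then have "\<forall>\<^sub>F n in sequentially. real n / real (m n) < 1 / 4"
      by (rule order_tendstoD) simp
    then show ?thesis
    proof eventually_elim
      case (elim n)
      then show ?case using m_pos[of n] by (simp add: field_simps)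
    qed
  qed
  have "\<forall>\<^sub>F n in sequentially. ?q n < 1 / 4"
    using q0 by (rule order_tendstoD) simp
  then have ne: "\<forall>\<^sub>F n in sequentially. codes n (m n) \<noteq> {}"
    using eventually_ge_at_top[of 2]
  proof eventually_elim
    case (elim n)
    then have "real (4 * m n) \<le> real (n\<^sup>2)" by (simp add: field_simps)
    then have "4 * m n \<le> n\<^sup>2" using of_nat_le_iff by blast
    then show ?case using elim codes_nonempty_square by blast
  qed
  have good: "\<forall>\<^sub>F n in sequentially. codes n (m n) \<noteq> {} \<and> 4 * n \<le> m n \<and> 8 \<le> n \<and> j n + k n \<le> n"
    using ne big eventually_ge_at_top[of 8] j_le by eventually_elim auto
  {
    assume "(\<lambda>n. real (k n)) \<lless> (\<lambda>n. real (m n) / real n)"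
    then have k0: "(\<lambda>n. real (k n) / (real (m n) / real n)) \<longlonglongrightarrow> 0"
      by (simp add: much_less_def)
    \<comment> \<open>The product simplifies to k / n, so eventually \<open>k n\<close> is at most
      half of \<open>n\<close>.\<close>
    have "(\<lambda>n. real (k n) / (real (m n) / real n) * ?q n) \<longlonglongrightarrow> 0"
      using tendsto_mult[OF k0 q0] by simp
    then have "\<forall>\<^sub>F n in sequentially. real (k n) / (real (m n) / real n) * ?q n < 1 / 2"
      by (rule order_tendstoD) simp
    then have k_le: "\<forall>\<^sub>F n in sequentially. 2 * k n \<le> n"
      using eventually_ge_at_top[of 1]
    proof eventually_elim
      case (elim n)
      then show ?case using m_pos[of n] by (simp add: field_simps power2_eq_square)
    qed
    have "(\<lambda>n. ?pr n - 1 / 2) \<longlonglongrightarrow> 0"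
    proof (rule Lim_null_comparison)
      show "\<forall>\<^sub>F n in sequentially. norm (?pr n - 1 / 2)
          \<le> 64 * ?q n + 32 * (real (k n) / (real (m n) / real n))"
        using good k_le
      proof eventually_elim
        case (elim n)
        then show ?case
          using prob_inversion_near[of n "m n" "j n" "k n"] j_pos[of n] k_pos[of n] by simp
      qed
      show "(\<lambda>n. 64 * ?q n + 32 * (real (k n) / (real (m n) / real n))) \<longlonglongrightarrow> 0"
        by (intro tendsto_add_zero tendsto_mult_right_zero q0 k0)
    qed
    then show "?pr \<longlonglongrightarrow> 1 / 2" by (rule LIM_zero_cancel)
  }
  {
    assume "(\<lambda>n. real (m n) / real n) \<lless> (\<lambda>n. real (k n))"
    then have k0: "(\<lambda>n. (real (m n) / real n) / real (k n)) \<longlonglongrightarrow> 0"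
      by (simp add: much_less_def)
    show "?pr \<longlonglongrightarrow> 0"
    proof (rule Lim_null_comparison)
      show "\<forall>\<^sub>F n in sequentially. norm (?pr n)
          \<le> 32 * ((real (m n) / real n) / real (k n)) + 128 * ?q n"
        using good
      proof eventually_elim
        case (elim n)
        then show ?case
          using prob_inversion_far[of n "m n" "j n" "k n"] j_pos[of n] k_pos[of n] by simp
      qed
      show "(\<lambda>n. 32 * ((real (m n) / real n) / real (k n)) + 128 * ?q n) \<longlonglongrightarrow> 0"
        by (intro tendsto_add_zero tendsto_mult_right_zero q0 k0)
    qed
  }
qed

end
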